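(* Let $I$ be an index set and let $F:[0,+\infty]^I\to[0,+\infty]$ be a function. The following statements are equivalent: (1) $F\in\mathsf{se}\mathscr{P}(\mathsf{P}_+^I,\mathsf{P}_+)$, i.e. $F$ is separately preserving; (2) $F$ is a quasi-metric modular aggregation function on products; (3) $F$ is isotone, subadditive and $F^{-1}(0)=\{0_I\}$.
   Context: A quasi-metric modular on a nonempty set $X$ is a function $w:(0,+\infty)\times X\times X\to[0,+\infty]$ such that for all $x,y,z\in X$ and $t,s>0$: $w(t,x,x)=0$; $w(t+s,x,y)\le w(t,x,z)+w(s,z,y)$; and, for all $x,y\in X$, one has $w(t,x,y)=w(t,y,x)=0$ for every $t>0$ if and only if $x=y$. The pair $(X,w)$ is then a quasi-metric modular space. $F:[0,+\infty]^I\to[0,+\infty]$ is a quasi-metric modular aggregation function on products if for every family $\{(X_i,w_i):i\in I\}$ of quasi-metric modular spaces the function $(t,x,y)\mapsto F\big((w_i(t,x_i,y_i))_{i\in I}\big)$ is a quasi-metric modular on $\prod_{i\in I}X_i$. Quantale means commutative integral quantale: a complete lattice $(\mathscr{V},\preceq)$ with an associative commutative operation $\ast$ distributing over arbitrary suprema, with a unit $1_{\mathscr V}$ equal to the top element. $\mathsf{P}_+=([0,+\infty],\le^{op},+)$, where $x\le^{op}y$ iff $y\le x$ (unit $0$); $\mathsf{P}_+^I$ is the product quantale on $[0,+\infty]^I$ with componentwise order and operation, with unit $0_I=(0)_{i\in I}$. For a quantale $(\mathscr{V},\preceq,\ast)$, a $\mathscr{V}$-category is a pair $(X,a)$ with $X$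 a nonempty set and $a:X\times X\to\mathscr{V}$ such that $1_{\mathscr V}\preceq a(x,x)$ and $a(x,z)\ast a(z,y)\preceq a(x,y)$ for all $x,y,z\in X$. It is separated if $1_{\mathscr V}\preceq a(x,y)$ and $1_{\mathscr V}\preceq a(y,x)$ imply $x=y$. A map $F:\mathscr{V}\to\mathscr{W}$ between quantales is separately preserving if $(X,F\circ a)$ is a separated $\mathscr{W}$-category for every separated $\mathscr{V}$-category $(X,a)$; $\mathsf{se}\mathscr{P}(\mathscr{V},\mathscr{W})$ is the set of such maps. Isotone means: $x\le y$ componentwise implies $F(x)\le F(y)$. Subadditive means $F(x+y)\le F(x)+F(y)$ for all $x,y\in[0,+\infty]^I$. *)

theory Defs
  imports "HOL-Analysis.Analysis" "HOL-Algebra.Group"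
begin

text \<open>
  Conventions. The interval \<open>[0, +\<infinity>]\<close> is the type \<^typ>\<open>ennreal\<close>. A product over an index set
  \<open>I\<close> (possibly empty) is the extensional product \<open>\<Pi>\<^sub>E i\<in>I. X i\<close>, so \<open>[0, +\<infinity>]\<^sup>I\<close> is
  \<open>I \<rightarrow>\<^sub>E UNIV\<close>, and its elements are written with the restricting abstraction \<open>\<lambda>i\<in>I. _\<close>.

  A quantification over ``all sets \<open>X\<close>'' becomes a quantification over all subsets of a type of
  points, which is passed as an argument of type \<^typ>\<open>'x itself\<close>. The sets of a family
  \<open>(X i)\<close> share one such type; this is no restriction, as they all embed in their disjoint union.
  Both notions with such an argument are inherited by every type that embeds in the given one
  (see \<open>separately_preserving_mono\<close> and \<open>modular_aggregation_on_products_mono\<close> below). A fixed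
  type of one or two points would admit too few spaces, hence theorems about these notions should
  be stated for an arbitrary infinite type of points; since every set embeds in an infinite one,
  no space is lost in this way.
\<close>


section \<open>Quantales\<close>

record 'a quantale_struct = "'a gorder" +
  tensor :: "'a \<Rightarrow> 'a \<Rightarrow> 'a"
  qunit :: 'a

definition tensor_monoid :: "('a, 'm) quantale_struct_scheme \<Rightarrow> 'a monoid"
  where "tensor_monoid V = \<lparr>carrier = carrier V, monoid.mult = tensor V, one = qunit V\<rparr>"

definition quantale :: "('a, 'm) quantale_struct_scheme \<Rightarrow> bool"
  where "quantale V \<longleftrightarrow>
    complete_lattice V \<and>
    comm_monoid (tensor_monoid V) \<and>
    (\<forall>x\<in>carrier V. \<forall>A. A \<subseteq> carrier V \<longrightarrow> tensor V x (\<Squnion>\<^bsub>V\<^esub>A) = \<Squnion>\<^bsub>V\<^esub>(tensor V x ` A)) \<and>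
    qunit V = \<top>\<^bsub>V\<^esub>"

definition P_plus :: "ennreal quantale_struct"
  where "P_plus =
    \<lparr>carrier = UNIV, eq = (=), le = (\<lambda>x y. y \<le> x), tensor = (+), qunit = 0\<rparr>"

definition prod_quantale :: "'i set \<Rightarrow> ('i \<Rightarrow> 'a quantale_struct) \<Rightarrow> ('i \<Rightarrow> 'a) quantale_struct"
  where "prod_quantale I V =
    \<lparr>carrier = (\<Pi>\<^sub>E i\<in>I. carrier (V i)),
     eq = (=),
     le = (\<lambda>x y. \<forall>i\<in>I. x i \<sqsubseteq>\<^bsub>V i\<^esub> y i),
     tensor = (\<lambda>x y. \<lambda>i\<in>I. tensor (V i) (x i) (y i)),
     qunit = (\<lambda>i\<in>I. qunit (V i))\<rparr>"

abbreviation P_plus_power :: "'i set \<Rightarrow> ('i \<Rightarrow> ennreal) quantale_struct"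
  where "P_plus_power I \<equiv> prod_quantale I (\<lambda>_. P_plus)"


section \<open>Categories enriched in a quantale\<close>

definition v_category ::
    "('v, 'm) quantale_struct_scheme \<Rightarrow> 'x set \<Rightarrow> ('x \<Rightarrow> 'x \<Rightarrow> 'v) \<Rightarrow> bool"
  where "v_category V X a \<longleftrightarrow>
    X \<noteq> {} \<and>
    (\<forall>x\<in>X. \<forall>y\<in>X. a x y \<in> carrier V) \<and>
    (\<forall>x\<in>X. qunit V \<sqsubseteq>\<^bsub>V\<^esub> a x x) \<and>
    (\<forall>x\<in>X. \<forall>y\<in>X. \<forall>z\<in>X. tensor V (a x z) (a z y) \<sqsubseteq>\<^bsub>V\<^esub> a x y)"

definition separated_v_category ::
    "('v, 'm) quantale_struct_scheme \<Rightarrow> 'x set \<Rightarrow> ('x \<Rightarrow> 'x \<Rightarrow> 'v) \<Rightarrow> bool"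
  where "separated_v_category V X a \<longleftrightarrow>
    v_category V X a \<and>
    (\<forall>x\<in>X. \<forall>y\<in>X. qunit V \<sqsubseteq>\<^bsub>V\<^esub> a x y \<and> qunit V \<sqsubseteq>\<^bsub>V\<^esub> a y x \<longrightarrow> x = y)"

definition separately_preserving ::
    "'x itself \<Rightarrow> ('v, 'm) quantale_struct_scheme \<Rightarrow> ('w, 'n) quantale_struct_scheme \<Rightarrow> ('v \<Rightarrow> 'w) set"
  where "separately_preserving _ V W =
    {F \<in> carrier V \<rightarrow> carrier W.
      \<forall>(X :: 'x set) a. separated_v_category V X a \<longrightarrow> separated_v_category W X (\<lambda>x y. F (a x y))}"


section \<open>Quasi-metric modulars\<close>

text \<open>The parameter \<open>t\<close> ranges over \<open>(0, +\<infinity>)\<close>: values of \<open>w\<close> at \<open>t \<le> 0\<close> are irrelevant.\<close>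

definition quasi_metric_modular :: "'x set \<Rightarrow> (real \<Rightarrow> 'x \<Rightarrow> 'x \<Rightarrow> ennreal) \<Rightarrow> bool"
  where "quasi_metric_modular X w \<longleftrightarrow>
    X \<noteq> {} \<and>
    (\<forall>t>0. \<forall>x\<in>X. w t x x = 0) \<and>
    (\<forall>t>0. \<forall>s>0. \<forall>x\<in>X. \<forall>y\<in>X. \<forall>z\<in>X. w (t + s) x y \<le> w t x z + w s z y) \<and>
    (\<forall>x\<in>X. \<forall>y\<in>X. (\<forall>t>0. w t x y = 0 \<and> w t y x = 0) \<longleftrightarrow> x = y)"

definition modular_aggregation_on_products ::
    "'x itself \<Rightarrow> 'i set \<Rightarrow> (('i \<Rightarrow> ennreal) \<Rightarrow> ennreal) \<Rightarrow> bool"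
  where "modular_aggregation_on_products _ I F \<longleftrightarrow>
    (\<forall>(X :: 'i \<Rightarrow> 'x set) w.
      (\<forall>i\<in>I. quasi_metric_modular (X i) (w i)) \<longrightarrow>
      quasi_metric_modular (\<Pi>\<^sub>E i\<in>I. X i) (\<lambda>t x y. F (\<lambda>i\<in>I. w i t (x i) (y i))))"


section \<open>Properties of functions on \<open>[0, +\<infinity>]\<^sup>I\<close>\<close>

definition isotone_on_product :: "'i set \<Rightarrow> (('i \<Rightarrow> ennreal) \<Rightarrow> ennreal) \<Rightarrow> bool"
  where "isotone_on_product I F \<longleftrightarrow>
    (\<forall>x \<in> I \<rightarrow>\<^sub>E UNIV. \<forall>y \<in> I \<rightarrow>\<^sub>E UNIV. (\<forall>i\<in>I. x i \<le> y i) \<longrightarrow> F x \<le> F y)"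

definition subadditive_on_product :: "'i set \<Rightarrow> (('i \<Rightarrow> ennreal) \<Rightarrow> ennreal) \<Rightarrow> bool"
  where "subadditive_on_product I F \<longleftrightarrow>
    (\<forall>x \<in> I \<rightarrow>\<^sub>E UNIV. \<forall>y \<in> I \<rightarrow>\<^sub>E UNIV. F (\<lambda>i\<in>I. x i + y i) \<le> F x + F y)"


section \<open>The structures above are quantales\<close>

lemma partial_order_P_plus: "partial_order P_plus"
  by unfold_locales (simp_all add: P_plus_def)

lemma least_Upper_P_plus: "least P_plus (Inf A) (Upper P_plus A)"
  unfolding least_def Upper_def P_plus_def by (auto intro: Inf_lower Inf_greatest)

lemma complete_lattice_P_plus: "complete_lattice P_plus"
proof (rule partial_order.complete_latticeI[OF partial_order_P_plus])
  fix A :: "ennreal set"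
  show "\<exists>s. least P_plus s (Upper P_plus A)"
    using least_Upper_P_plus ..
  have "greatest P_plus (Sup A) (Lower P_plus A)"
    unfolding greatest_def Lower_def P_plus_def by (auto intro: Sup_upper Sup_least)
  then show "\<exists>i. greatest P_plus i (Lower P_plus A)" ..
qed

lemma sup_eqI:
  assumes "partial_order L" and "least L s (Upper L A)"
  shows "\<Squnion>\<^bsub>L\<^esub>A = s"
proof -
  interpret partial_order L by fact
  have "least L (\<Squnion>\<^bsub>L\<^esub>A) (Upper L A)"
    unfolding sup_def using assms(2) by (rule someI)
  then show ?thesis
    using assms(2) by (rule least_unique)
qed

lemma top_eqI:
  assumes "partial_order L" and "greatest L u (carrier L)"
  shows "\<top>\<^bsub>L\<^esub> = u"
proof -
  interpret partial_order L by fact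
  have "greatest L (\<top>\<^bsub>L\<^esub>) (carrier L)"
    unfolding top_def using assms(2) by (rule someI)
  then show ?thesis
    using assms(2) by (rule greatest_unique)
qed

lemma ennreal_add_Inf: "x + Inf A = Inf ((+) x ` A)" for x :: ennreal
proof (rule antisym)
  show "x + Inf A \<le> Inf ((+) x ` A)"
    by (rule Inf_greatest) (auto intro: add_left_mono Inf_lower)
  show "Inf ((+) x ` A) \<le> x + Inf A"
  proof (cases "x = top_class.top")
    case True
    then have "x + Inf A = top_class.top" by (simp add: top_add)
    then show ?thesis by (simp only: top_greatest)
  next
    case False
    then have iff: "b - x \<le> c \<longleftrightarrow> b \<le> x + c" for b c
      by (simp only: ennreal_minus_le_iff simp_thms)
    have "Inf ((+) x ` A) - x \<le> a" if "a \<in> A" for a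
      unfolding iff using that by (intro Inf_lower imageI)
    then have "Inf ((+) x ` A) - x \<le> Inf A"
      by (rule Inf_greatest)
    then show ?thesis
      unfolding iff .
  qed
qed

lemma quantale_P_plus: "quantale P_plus"
proof -
  have "comm_monoid (tensor_monoid P_plus)"
    by (rule comm_monoidI) (simp_all add: tensor_monoid_def P_plus_def ac_simps)
  moreover have "\<Squnion>\<^bsub>P_plus\<^esub>A = Inf A" for A
    using partial_order_P_plus least_Upper_P_plus by (rule sup_eqI)
  moreover have "greatest P_plus 0 (carrier P_plus)"
    by (simp add: greatest_def P_plus_def)
  then have "\<top>\<^bsub>P_plus\<^esub> = 0"
    by (rule top_eqI[OF partial_order_P_plus])
  moreover have "tensor P_plus = (+)" "qunit P_plus = 0"
    by (simp_all add: P_plus_def)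
  ultimately show ?thesis
    using complete_lattice_P_plus by (simp add: quantale_def ennreal_add_Inf)
qed

lemma quantale_prod_quantale:
  assumes V: "\<And>i. i \<in> I \<Longrightarrow> quantale (V i)"
  shows "quantale (prod_quantale I V)"
proof -
  let ?P = "prod_quantale I V"
  note P = prod_quantale_def
  have cl: "complete_lattice (V i)" and cm: "comm_monoid (tensor_monoid (V i))"
    and dist: "\<And>x A. x \<in> carrier (V i) \<Longrightarrow> A \<subseteq> carrier (V i) \<Longrightarrow>
      tensor (V i) x (\<Squnion>\<^bsub>V i\<^esub>A) = \<Squnion>\<^bsub>V i\<^esub>(tensor (V i) x ` A)"
    and top: "qunit (V i) = \<top>\<^bsub>V i\<^esub>" if "i \<in> I" for i
    using V[OF that] by (simp_all add: quantale_def)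
  have po: "partial_order (V i)" if "i \<in> I" for i
    using cl[OF that] by (rule complete_lattice.axioms)
  then have wpo: "weak_partial_order (V i)" if "i \<in> I" for i
    using that by (simp add: partial_order.axioms)
  have po_P: "partial_order ?P"
  proof unfold_locales
    fix x y
    assume xy: "x \<sqsubseteq>\<^bsub>?P\<^esub> y" "y \<sqsubseteq>\<^bsub>?P\<^esub> x" "x \<in> carrier ?P" "y \<in> carrier ?P"
    have "x i = y i" if "i \<in> I" for i
      using xy that by (intro partial_order.le_antisym[OF po]) (auto simp: P)
    then have "x = y"
      using xy by (intro PiE_ext[of x I "\<lambda>i. carrier (V i)"]) (auto simp: P)
    then show "x .=\<^bsub>?P\<^esub> y"
      by (simp add: P)
  next
    fix x y z
    assume xyz: "x \<sqsubseteq>\<^bsub>?P\<^esub> y" "y \<sqsubseteq>\<^bsub>?P\<^esub> z" "x \<in> carrier ?P" "y \<in> carrier ?P" "z \<in> carrier ?P"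
    have "x i \<sqsubseteq>\<^bsub>V i\<^esub> z i" if "i \<in> I" for i
      using xyz that
      by (intro weak_partial_order.le_trans[OF wpo, of i "x i" "y i" "z i"]) (auto simp: P)
    then show "x \<sqsubseteq>\<^bsub>?P\<^esub> z"
      by (simp add: P)
  qed (auto simp: P intro: weak_partial_order.le_refl[OF wpo])
  have least_P: "least ?P (\<lambda>i\<in>I. \<Squnion>\<^bsub>V i\<^esub>((\<lambda>x. x i) ` A)) (Upper ?P A)" if A: "A \<subseteq> carrier ?P" for A
  proof -
    have sub: "(\<lambda>x. x i) ` A \<subseteq> carrier (V i)" if "i \<in> I" for i
      using A that by (auto simp: P)
    have wcl: "weak_complete_lattice (V i)" if "i \<in> I" for i
      using cl[OF that] by (simp add: complete_lattice_def weak_complete_lattice_def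
          weak_complete_lattice_axioms_def complete_lattice_axioms_def wpo that)
    have lub: "least (V i) (\<Squnion>\<^bsub>V i\<^esub>((\<lambda>x. x i) ` A)) (Upper (V i) ((\<lambda>x. x i) ` A))" if "i \<in> I" for i
      by (rule weak_complete_lattice.supI[OF wcl[OF that] _ sub[OF that]])
    have closed: "\<Squnion>\<^bsub>V i\<^esub>((\<lambda>x. x i) ` A) \<in> carrier (V i)" if "i \<in> I" for i
      using lub[OF that] by (auto simp: least_def Upper_def)
    show ?thesis
      unfolding least_def
    proof (intro conjI ballI)
      have "x i \<sqsubseteq>\<^bsub>V i\<^esub> \<Squnion>\<^bsub>V i\<^esub>((\<lambda>x. x i) ` A)" if "x \<in> A" "i \<in> I" for x i
        using lub[OF \<open>i \<in> I\<close>] sub[OF \<open>i \<in> I\<close>] \<open>x \<in> A\<close> by (auto simp: least_def Upper_def)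
      then show "(\<lambda>i\<in>I. \<Squnion>\<^bsub>V i\<^esub>((\<lambda>x. x i) ` A)) \<in> Upper ?P A"
        using closed by (auto simp: Upper_def P)
    next
      fix u assume u: "u \<in> Upper ?P A"
      have "\<Squnion>\<^bsub>V i\<^esub>((\<lambda>x. x i) ` A) \<sqsubseteq>\<^bsub>V i\<^esub> u i" if "i \<in> I" for i
      proof -
        have "u i \<in> Upper (V i) ((\<lambda>x. x i) ` A)"
          using u that A by (auto simp: Upper_def P)
        then show ?thesis
          using lub[OF that] by (simp add: least_def)
      qed
      then show "(\<lambda>i\<in>I. \<Squnion>\<^bsub>V i\<^esub>((\<lambda>x. x i) ` A)) \<sqsubseteq>\<^bsub>?P\<^esub> u"
        by (simp add: P)
    qed simp
  qed
  have top_P: "greatest ?P (qunit ?P) (carrier ?P)"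
  proof -
    have greatest: "greatest (V i) (qunit (V i)) (carrier (V i))" if "i \<in> I" for i
    proof -
      have "\<exists>g. greatest (V i) g (Lower (V i) {})"
        by (rule complete_lattice.inf_exists[OF cl[OF that]]) simp
      then obtain g where "greatest (V i) g (Lower (V i) {})" ..
      then have "greatest (V i) g (carrier (V i))"
        by (simp add: Lower_def)
      then show ?thesis
        using top_eqI[OF po[OF that]] top[OF that] by simp
    qed
    have "x i \<sqsubseteq>\<^bsub>V i\<^esub> qunit (V i)" if "x \<in> carrier ?P" "i \<in> I" for x i
    proof -
      have "x i \<in> carrier (V i)"
        using that by (auto simp: P)
      then show ?thesis
        using greatest[OF that(2)] by (simp add: greatest_def)
    qed
    then show ?thesis
      using greatest by (auto simp: greatest_def P)
  qed
  have cl_P: "complete_lattice ?P"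
  proof (rule partial_order.complete_lattice_criterion1[OF po_P])
    show "\<exists>g. greatest ?P g (carrier ?P)"
      by (rule exI) (rule top_P)
    fix A assume A: "A \<subseteq> carrier ?P"
    have "Lower ?P A \<subseteq> carrier ?P"
      by (auto simp: Lower_def)
    from least_P[OF this] obtain s where s: "least ?P s (Upper ?P (Lower ?P A))"
      by blast
    have "s \<in> Lower ?P A"
    proof -
      have "s \<sqsubseteq>\<^bsub>?P\<^esub> a" if "a \<in> A" for a
      proof -
        have "a \<in> Upper ?P (Lower ?P A)"
          using that A by (auto simp: Upper_def Lower_def)
        then show ?thesis
          using s by (simp add: least_def)
      qed
      then show ?thesis
        using s by (auto simp: Lower_def least_def Upper_def)
    qed
    moreover have "l \<sqsubseteq>\<^bsub>?P\<^esub> s" if "l \<in> Lower ?P A" for l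
      using s that by (auto simp: least_def Upper_def Lower_def)
    ultimately have glb: "greatest ?P s (Lower ?P A)"
      by (auto simp: greatest_def Lower_def)
    show "\<exists>i. greatest ?P i (Lower ?P A)"
      by (rule exI) (rule glb)
  qed
  have closed: "tensor (V i) x y \<in> carrier (V i)"
    and comm: "tensor (V i) x y = tensor (V i) y x"
    if "i \<in> I" "x \<in> carrier (V i)" "y \<in> carrier (V i)" for i x y
    using comm_monoid.m_comm[OF cm[OF that(1)], of x y]
      monoid.m_closed[OF comm_monoid.axioms(1)[OF cm[OF that(1)]], of x y] that
    by (simp_all add: tensor_monoid_def)
  have assoc: "tensor (V i) (tensor (V i) x y) z = tensor (V i) x (tensor (V i) y z)"
    if "i \<in> I" "x \<in> carrier (V i)" "y \<in> carrier (V i)" "z \<in> carrier (V i)" for i x y z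
    using monoid.m_assoc[OF comm_monoid.axioms(1)[OF cm[OF that(1)]], of x y z] that
    by (simp add: tensor_monoid_def)
  have unit: "tensor (V i) (qunit (V i)) x = x" if "i \<in> I" "x \<in> carrier (V i)" for i x
    using monoid.l_one[OF comm_monoid.axioms(1)[OF cm[OF that(1)]], of x] that
    by (simp add: tensor_monoid_def)
  have one: "qunit (V i) \<in> carrier (V i)" if "i \<in> I" for i
    using monoid.one_closed[OF comm_monoid.axioms(1)[OF cm[OF that]]] by (simp add: tensor_monoid_def)
  have mem: "x i \<in> carrier (V i)" if "x \<in> carrier (tensor_monoid ?P)" "i \<in> I" for x i
    using that by (auto simp: tensor_monoid_def P)
  have mult_P: "x \<otimes>\<^bsub>tensor_monoid ?P\<^esub> y = (\<lambda>i\<in>I. tensor (V i) (x i) (y i))" for x y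
    by (simp add: tensor_monoid_def P)
  have one_P: "\<one>\<^bsub>tensor_monoid ?P\<^esub> = (\<lambda>i\<in>I. qunit (V i))"
    by (simp add: tensor_monoid_def P)
  have carrier_P: "carrier (tensor_monoid ?P) = (\<Pi>\<^sub>E i\<in>I. carrier (V i))"
    by (simp add: tensor_monoid_def P)
  have cm_P: "comm_monoid (tensor_monoid ?P)"
  proof (rule comm_monoidI)
    fix x y
    assume xy: "x \<in> carrier (tensor_monoid ?P)" "y \<in> carrier (tensor_monoid ?P)"
    show "x \<otimes>\<^bsub>tensor_monoid ?P\<^esub> y \<in> carrier (tensor_monoid ?P)"
      unfolding mult_P carrier_P by (simp add: closed mem xy)
    show "x \<otimes>\<^bsub>tensor_monoid ?P\<^esub> y = y \<otimes>\<^bsub>tensor_monoid ?P\<^esub> x"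
      unfolding mult_P by (rule restrict_ext) (rule comm; simp add: mem xy)
  next
    fix x y z
    assume "x \<in> carrier (tensor_monoid ?P)" "y \<in> carrier (tensor_monoid ?P)"
      "z \<in> carrier (tensor_monoid ?P)"
    then show "x \<otimes>\<^bsub>tensor_monoid ?P\<^esub> y \<otimes>\<^bsub>tensor_monoid ?P\<^esub> z =
        x \<otimes>\<^bsub>tensor_monoid ?P\<^esub> (y \<otimes>\<^bsub>tensor_monoid ?P\<^esub> z)"
      unfolding mult_P by (intro restrict_ext) (simp add: assoc mem)
  next
    fix x assume x: "x \<in> carrier (tensor_monoid ?P)"
    have "\<one>\<^bsub>tensor_monoid ?P\<^esub> \<otimes>\<^bsub>tensor_monoid ?P\<^esub> x = restrict x I"
      unfolding mult_P one_P by (rule restrict_ext) (simp add: unit mem[OF x])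
    also have "\<dots> = x"
      using x unfolding carrier_P by (rule PiE_restrict)
    finally show "\<one>\<^bsub>tensor_monoid ?P\<^esub> \<otimes>\<^bsub>tensor_monoid ?P\<^esub> x = x" .
  next
    show "\<one>\<^bsub>tensor_monoid ?P\<^esub> \<in> carrier (tensor_monoid ?P)"
      unfolding one_P carrier_P by (simp add: one)
  qed
  have "tensor ?P x (\<Squnion>\<^bsub>?P\<^esub>A) = \<Squnion>\<^bsub>?P\<^esub>(tensor ?P x ` A)"
    if x: "x \<in> carrier ?P" and A: "A \<subseteq> carrier ?P" for x A
  proof -
    have x': "x i \<in> carrier (V i)" and A': "(\<lambda>a. a i) ` A \<subseteq> carrier (V i)" if "i \<in> I" for i
      using x A that by (auto simp: P)
    have A'': "tensor ?P x ` A \<subseteq> carrier ?P"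
    proof (rule image_subsetI)
      fix a assume "a \<in> A"
      then have "a i \<in> carrier (V i)" if "i \<in> I" for i
        using A' that by auto
      then show "tensor ?P x a \<in> carrier ?P"
        using x' by (simp add: P closed)
    qed
    have "tensor ?P x (\<Squnion>\<^bsub>?P\<^esub>A) =
        (\<lambda>i\<in>I. tensor (V i) (x i) (\<Squnion>\<^bsub>V i\<^esub>((\<lambda>a. a i) ` A)))"
      unfolding sup_eqI[OF po_P least_P[OF A]] by (auto simp: P intro!: restrict_ext)
    also have "\<dots> = (\<lambda>i\<in>I. \<Squnion>\<^bsub>V i\<^esub>((\<lambda>a. a i) ` tensor ?P x ` A))"
    proof (rule restrict_ext)
      fix i assume i: "i \<in> I"
      then have "(\<lambda>a. a i) ` tensor ?P x ` A = tensor (V i) (x i) ` (\<lambda>a. a i) ` A"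
        by (simp add: P image_image)
      then show "tensor (V i) (x i) (\<Squnion>\<^bsub>V i\<^esub>((\<lambda>a. a i) ` A)) =
          \<Squnion>\<^bsub>V i\<^esub>((\<lambda>a. a i) ` tensor ?P x ` A)"
        using dist[OF i x'[OF i] A'[OF i]] by simp
    qed
    also have "\<dots> = \<Squnion>\<^bsub>?P\<^esub>(tensor ?P x ` A)"
      by (rule sup_eqI[OF po_P least_P[OF A''], symmetric])
    finally show ?thesis .
  qed
  then show ?thesis
    unfolding quantale_def using cl_P cm_P top_eqI[OF po_P top_P] by simp
qed

lemma quantale_P_plus_power: "quantale (P_plus_power I)"
  using quantale_P_plus by (rule quantale_prod_quantale)


section \<open>Change of the type of points\<close>

lemma separately_preserving_mono:
  fixes f :: "'x \<Rightarrow> 'y"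
    and V :: "('v, 'm) quantale_struct_scheme" and W :: "('w, 'n) quantale_struct_scheme"
  assumes f: "inj f" and F: "F \<in> separately_preserving TYPE('y) V W"
  shows "F \<in> separately_preserving TYPE('x) V W"
proof -
  have iff: "separated_v_category U (f ` X) (\<lambda>x y. b (inv_into UNIV f x) (inv_into UNIV f y)) \<longleftrightarrow>
      separated_v_category U X b"
    for U :: "('u, 'k) quantale_struct_scheme" and X :: "'x set" and b :: "'x \<Rightarrow> 'x \<Rightarrow> 'u"
    using f by (simp add: separated_v_category_def v_category_def inj_eq)
  show ?thesis
    unfolding separately_preserving_def
  proof (intro CollectI conjI allI impI)
    show "F \<in> carrier V \<rightarrow> carrier W"
      using F by (simp add: separately_preserving_def)
    fix X :: "'x set" and a
    assume "separated_v_category V X a"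
    then have "separated_v_category V (f ` X) (\<lambda>x y. a (inv_into UNIV f x) (inv_into UNIV f y))"
      by (simp add: iff)
    then have "separated_v_category W (f ` X) (\<lambda>x y. F (a (inv_into UNIV f x) (inv_into UNIV f y)))"
      using F by (simp add: separately_preserving_def)
    then show "separated_v_category W X (\<lambda>x y. F (a x y))"
      by (simp add: iff[of W X "\<lambda>x y. F (a x y)"])
  qed
qed

lemma quasi_metric_modular_pullback:
  assumes "quasi_metric_modular Y w" "g ` X \<subseteq> Y" "inj_on g X" "X \<noteq> {}"
  shows "quasi_metric_modular X (\<lambda>t x y. w t (g x) (g y))"
proof -
  have g: "g x \<in> Y" if "x \<in> X" for x
    using that assms(2) by blast
  have eq: "g x = g y \<longleftrightarrow> x = y" if "x \<in> X" "y \<in> X" for x y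
    using that assms(3) by (simp add: inj_on_eq_iff)
  show ?thesis
    using assms(1,4) unfolding quasi_metric_modular_def by (simp add: g eq[symmetric])
qed

lemma modular_aggregation_on_products_mono:
  fixes f :: "'x \<Rightarrow> 'y" and I :: "'i set"
  assumes f: "inj f" and F: "modular_aggregation_on_products TYPE('y) I F"
  shows "modular_aggregation_on_products TYPE('x) I F"
  unfolding modular_aggregation_on_products_def
proof (intro allI impI)
  fix X :: "'i \<Rightarrow> 'x set" and w
  assume w: "\<forall>i\<in>I. quasi_metric_modular (X i) (w i)"
  let ?w = "\<lambda>i t x y. w i t (inv_into UNIV f x) (inv_into UNIV f y)"
  let ?g = "\<lambda>x. \<lambda>i\<in>I. f (x i)"
  have "\<forall>i\<in>I. quasi_metric_modular (f ` X i) (?w i)"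
  proof
    fix i assume i: "i \<in> I"
    show "quasi_metric_modular (f ` X i) (?w i)"
    proof (rule quasi_metric_modular_pullback)
      show "quasi_metric_modular (X i) (w i)" using w i by blast
      then show "f ` X i \<noteq> {}" by (simp add: quasi_metric_modular_def)
      show "inj_on (inv_into UNIV f) (f ` X i)" by (meson inj_on_inv_into image_mono subset_UNIV)
    qed (use f in auto)
  qed
  then have "quasi_metric_modular (\<Pi>\<^sub>E i\<in>I. f ` X i) (\<lambda>t x y. F (\<lambda>i\<in>I. ?w i t (x i) (y i)))"
    using F[unfolded modular_aggregation_on_products_def, THEN spec, THEN spec,
        of "\<lambda>i. f ` X i" ?w] by simp
  then have "quasi_metric_modular (\<Pi>\<^sub>E i\<in>I. X i)
      (\<lambda>t x y. F (\<lambda>i\<in>I. ?w i t (?g x i) (?g y i)))"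
  proof (rule quasi_metric_modular_pullback)
    show "?g ` (\<Pi>\<^sub>E i\<in>I. X i) \<subseteq> (\<Pi>\<^sub>E i\<in>I. f ` X i)"
      by auto
    show "inj_on ?g (\<Pi>\<^sub>E i\<in>I. X i)"
    proof (rule inj_onI)
      fix x y assume xy: "x \<in> (\<Pi>\<^sub>E i\<in>I. X i)" "y \<in> (\<Pi>\<^sub>E i\<in>I. X i)" "?g x = ?g y"
      have "x i = y i" if "i \<in> I" for i
        using fun_cong[OF xy(3), of i] that f by (simp add: inj_eq)
      with xy(1,2) show "x = y" by (rule PiE_ext)
    qed
    show "(\<Pi>\<^sub>E i\<in>I. X i) \<noteq> {}"
      using w by (auto simp: PiE_eq_empty_iff quasi_metric_modular_def)
  qed
  moreover have "(\<lambda>i\<in>I. ?w i t (?g x i) (?g y i)) = (\<lambda>i\<in>I. w i t (x i) (y i))" for t x y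
    using f by (intro restrict_ext) simp
  ultimately show "quasi_metric_modular (\<Pi>\<^sub>E i\<in>I. X i) (\<lambda>t x y. F (\<lambda>i\<in>I. w i t (x i) (y i)))"
    by simp
qed

end

theory Submission
  imports Defs
begin

text \<open>
  A function \<open>F\<close> satisfies condition (3) iff it vanishes exactly at \<open>0\<close> and preserves triangles:
  \<open>c \<le> x + y\<close> implies \<open>F c \<le> F x + F y\<close>. This is all that is needed to transport the axioms of a
  separated category or of a modular along \<open>F\<close>. Conversely, a triangle is realised by three points
  \<open>p, z, q\<close> with distances \<open>c\<close> from \<open>p\<close> to \<open>q\<close>, \<open>x\<close> from \<open>p\<close> to \<open>z\<close> and \<open>y\<close> from \<open>z\<close> to \<open>q\<close>, where
  all backward distances are \<open>\<infinity>\<close>, so that the space is separated even if some of \<open>c, x, y\<close> vanish.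
  A vector \<open>v \<noteq> 0\<close> with \<open>F v = 0\<close> is excluded by two points at distance \<open>v\<close> in both directions.
\<close>

section \<open>Condition (3) as preservation of triangles\<close>

definition triangle_preserving :: "'i set \<Rightarrow> (('i \<Rightarrow> ennreal) \<Rightarrow> ennreal) \<Rightarrow> bool"
  where "triangle_preserving I F \<longleftrightarrow>
    (\<forall>c \<in> I \<rightarrow>\<^sub>E UNIV. \<forall>x \<in> I \<rightarrow>\<^sub>E UNIV. \<forall>y \<in> I \<rightarrow>\<^sub>E UNIV.
      (\<forall>i\<in>I. c i \<le> x i + y i) \<longrightarrow> F c \<le> F x + F y)"

lemma triangle_preservingD:
  assumes "triangle_preserving I F"
    and "c \<in> I \<rightarrow>\<^sub>E UNIV" "x \<in> I \<rightarrow>\<^sub>E UNIV" "y \<in> I \<rightarrow>\<^sub>E UNIV"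
    and "\<And>i. i \<in> I \<Longrightarrow> c i \<le> x i + y i"
  shows "F c \<le> F x + F y"
  using assms unfolding triangle_preserving_def by blast

text \<open>Isotonicity is the case of a triangle with one side \<open>0\<close>, where
  \<open>F\<close> must vanish at \<open>0\<close>; subadditivity is the degenerate triangle
  \<open>c = x + y\<close>. Conversely, \<open>F c\<close> is bounded by the value at
  \<open>x + y\<close>, and that by \<open>F x + F y\<close>.\<close>

lemma triangle_preserving_iff:
  assumes "F (\<lambda>i\<in>I. 0) = 0"
  shows "triangle_preserving I F \<longleftrightarrow> isotone_on_product I F \<and> subadditive_on_product I F"
proof (intro iffI conjI)
  assume F: "triangle_preserving I F"
  show "isotone_on_product I F"
    unfolding isotone_on_product_def
  proof (intro ballI impI)
    fix x y :: "'a \<Rightarrow> ennreal"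
    assume "x \<in> I \<rightarrow>\<^sub>E UNIV" "y \<in> I \<rightarrow>\<^sub>E UNIV" "\<forall>i\<in>I. x i \<le> y i"
    then have "F x \<le> F y + F (\<lambda>i\<in>I. 0)"
      by (intro triangle_preservingD[OF F]) auto
    then show "F x \<le> F y" by (simp add: assms)
  qed
  show "subadditive_on_product I F"
    unfolding subadditive_on_product_def
    by (intro ballI triangle_preservingD[OF F]) auto
next
  assume F: "isotone_on_product I F \<and> subadditive_on_product I F"
  show "triangle_preserving I F"
    unfolding triangle_preserving_def
  proof (intro ballI impI)
    fix c x y :: "'a \<Rightarrow> ennreal"
    assume c: "c \<in> I \<rightarrow>\<^sub>E UNIV" and xy: "x \<in> I \<rightarrow>\<^sub>E UNIV" "y \<in> I \<rightarrow>\<^sub>E UNIV"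
      and le: "\<forall>i\<in>I. c i \<le> x i + y i"
    have "F c \<le> F (\<lambda>i\<in>I. x i + y i)"
      using F[THEN conjunct1, unfolded isotone_on_product_def] c le by simp
    also have "\<dots> \<le> F x + F y"
      using F xy by (simp add: subadditive_on_product_def)
    finally show "F c \<le> F x + F y" .
  qed
qed

text \<open>Brings (3) into the form to which (1) and (2) are reduced below. Either description of
  the zero set supplies the value \<open>0\<close> at the zero vector.\<close>

lemma isotone_subadditive_zero_iff:
  "isotone_on_product I F \<and> subadditive_on_product I F \<and>
      {v \<in> I \<rightarrow>\<^sub>E UNIV. F v = 0} = {\<lambda>i\<in>I. 0} \<longleftrightarrow>
    triangle_preserving I F \<and> (\<forall>v \<in> I \<rightarrow>\<^sub>E UNIV. F v = 0 \<longleftrightarrow> v = (\<lambda>i\<in>I. 0))"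
proof -
  have zero: "{v \<in> I \<rightarrow>\<^sub>E UNIV. F v = 0} = {\<lambda>i\<in>I. 0} \<longleftrightarrow>
      (\<forall>v \<in> I \<rightarrow>\<^sub>E UNIV. F v = 0 \<longleftrightarrow> v = (\<lambda>i\<in>I. 0))"
    by (auto simp: set_eq_iff)
  have "F (\<lambda>i\<in>I. 0) = 0" if "\<forall>v \<in> I \<rightarrow>\<^sub>E UNIV. F v = 0 \<longleftrightarrow> v = (\<lambda>i\<in>I. 0)"
    using that by simp
  then show ?thesis
    unfolding zero using triangle_preserving_iff[of F I] by blast
qed

section \<open>Elementary form of separated categories over \<open>P_plus\<close> and its
  powers\<close>

lemma separated_v_category_P_plus_iff:
  "separated_v_category P_plus X a \<longleftrightarrow>
    X \<noteq> {} \<and> (\<forall>x\<in>X. a x x = 0) \<and>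
    (\<forall>x\<in>X. \<forall>y\<in>X. \<forall>z\<in>X. a x y \<le> a x z + a z y) \<and>
    (\<forall>x\<in>X. \<forall>y\<in>X. a x y = 0 \<and> a y x = 0 \<longrightarrow> x = y)"
  by (simp add: separated_v_category_def v_category_def P_plus_def)

lemma separated_v_category_P_plusD:
  assumes "separated_v_category P_plus X a" "x \<in> X" "y \<in> X" "a x y = 0" "a y x = 0"
  shows "x = y"
  using assms unfolding separated_v_category_P_plus_iff by blast

lemma restrict_zero_eq_iff:
  assumes v: "v \<in> I \<rightarrow>\<^sub>E UNIV"
  shows "v = (\<lambda>i\<in>I. 0) \<longleftrightarrow> (\<forall>i\<in>I. v i = 0)"
proof
  assume "\<forall>i\<in>I. v i = 0"
  with v show "v = (\<lambda>i\<in>I. 0)"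
    by (intro PiE_ext[OF v]) auto
qed simp

text \<open>Separation is a joint condition on all coordinates: a single coordinate of
  \<open>a\<close> may fail to separate points. For empty \<open>I\<close> it forces
  \<open>X\<close> to be a singleton.\<close>

lemma separated_v_category_P_plus_power_iff:
  "separated_v_category (P_plus_power I) X a \<longleftrightarrow>
    X \<noteq> {} \<and> (\<forall>x\<in>X. \<forall>y\<in>X. a x y \<in> I \<rightarrow>\<^sub>E UNIV) \<and>
    (\<forall>x\<in>X. \<forall>i\<in>I. a x x i = 0) \<and>
    (\<forall>x\<in>X. \<forall>y\<in>X. \<forall>z\<in>X. \<forall>i\<in>I. a x y i \<le> a x z i + a z y i) \<and>
    (\<forall>x\<in>X. \<forall>y\<in>X. (\<forall>i\<in>I. a x y i = 0) \<and> (\<forall>i\<in>I. a y x i = 0) \<longrightarrow> x = y)"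
  by (simp add: separated_v_category_def v_category_def prod_quantale_def P_plus_def)

section \<open>The three-point test space and facts on modulars\<close>

definition triangle_dist ::
    "'x \<Rightarrow> 'x \<Rightarrow> 'x \<Rightarrow> ennreal \<Rightarrow> ennreal \<Rightarrow> ennreal \<Rightarrow> 'x \<Rightarrow> 'x \<Rightarrow> ennreal"
  where "triangle_dist p z q c x y u v =
    (if u = v then 0 else if u = p \<and> v = q then c else if u = p \<and> v = z then x
     else if u = z \<and> v = q then y else \<infinity>)"

text \<open>The only detour through a third point without a step of length \<infinity> leads from
  \<open>p\<close> over \<open>z\<close> to \<open>q\<close>, and there the inequality is
  \<open>c \<le> x + y\<close>.\<close>

lemma triangle_dist_triangle:
  assumes "distinct [p, z, q]" "c \<le> x + y" "u \<in> {p, z, q}" "v \<in> {p, z, q}" "w \<in> {p, z, q}"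
  shows "triangle_dist p z q c x y u v \<le> triangle_dist p z q c x y u w + triangle_dist p z q c x y w v"
  using assms by (auto simp: triangle_dist_def)

lemma triangle_dist_separated:
  assumes "distinct [p, z, q]" "u \<in> {p, z, q}" "v \<in> {p, z, q}"
    and "triangle_dist p z q c x y u v = 0" "triangle_dist p z q c x y v u = 0"
  shows "u = v"
  using assms by (auto simp: triangle_dist_def split: if_splits)

lemma triangle_dist_simps:
  assumes "distinct [p, z, q]"
  shows "triangle_dist p z q c x y p q = c" "triangle_dist p z q c x y p z = x"
    "triangle_dist p z q c x y z q = y" "triangle_dist p z q c x y u u = 0"
  using assms by (auto simp: triangle_dist_def)

lemma quasi_metric_modular_triangle:
  assumes "quasi_metric_modular X w" "0 < t" "0 < s" "x \<in> X" "y \<in> X" "z \<in> X"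
  shows "w (t + s) x y \<le> w t x z + w s z y"
  using assms by (simp add: quasi_metric_modular_def)

lemma quasi_metric_modular_eq_iff:
  assumes "quasi_metric_modular X w" "x \<in> X" "y \<in> X"
  shows "(\<forall>t>0. w t x y = 0 \<and> w t y x = 0) \<longleftrightarrow> x = y"
  using assms unfolding quasi_metric_modular_def by blast

lemma infinite_UNIV_obtain_distinct3:
  assumes "infinite (UNIV :: 'x set)"
  obtains p z q :: 'x where "distinct [p, z, q]"
proof -
  obtain B :: "'x set" where "card B = 3"
    using infinite_arbitrarily_large[OF assms] by blast
  then show ?thesis
    using that unfolding card_3_iff by (metis distinct_length_2_or_more distinct_singleton)
qed

section \<open>Separately preserving functions\<close>

lemma separately_preserving_P_plus_power_iff:
  fixes F :: "('i \<Rightarrow> ennreal) \<Rightarrow> ennreal"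
  assumes "infinite (UNIV :: 'x set)"
  shows "F \<in> separately_preserving TYPE('x) (P_plus_power I) P_plus \<longleftrightarrow>
    triangle_preserving I F \<and> (\<forall>v \<in> I \<rightarrow>\<^sub>E UNIV. F v = 0 \<longleftrightarrow> v = (\<lambda>i\<in>I. 0))"
    (is "?L \<longleftrightarrow> ?R")
proof
  assume F: ?L
  obtain p z q :: 'x where d: "distinct [p, z, q]"
    using assms by (rule infinite_UNIV_obtain_distinct3)
  have sep: "separated_v_category P_plus X (\<lambda>x y. F (a x y))"
    if "separated_v_category (P_plus_power I) X a" for X :: "'x set" and a
    using F that by (simp add: separately_preserving_def)
  have "F c \<le> F x + F y"
    if mem: "c \<in> I \<rightarrow>\<^sub>E UNIV" "x \<in> I \<rightarrow>\<^sub>E UNIV" "y \<in> I \<rightarrow>\<^sub>E UNIV"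
      and le: "\<forall>i\<in>I. c i \<le> x i + y i" for c x y
  proof (cases "I = {}")
    \<comment> \<open>Without coordinates three points cannot be separated, but then
      \<open>c\<close>, \<open>x\<close> and \<open>y\<close> are the same function.\<close>
    case True
    then show ?thesis using mem by simp
  next
    case False
    define a where "a u v = (\<lambda>i\<in>I. triangle_dist p z q (c i) (x i) (y i) u v)" for u v
    have a: "a p q = c" "a p z = x" "a z q = y"
      using mem by (auto simp: a_def triangle_dist_simps[OF d] PiE_restrict)
    have "separated_v_category (P_plus_power I) {p, z, q} a"
      unfolding separated_v_category_P_plus_power_iff
    proof (intro conjI ballI impI)
      fix u v assume uv: "u \<in> {p, z, q}" "v \<in> {p, z, q}"
      \<comment> \<open>One coordinate is enough, since each of them already separates the three
        points.\<close>
      from False obtain i where i: "i \<in> I" by blast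
      assume "(\<forall>i\<in>I. a u v i = 0) \<and> (\<forall>i\<in>I. a v u i = 0)"
      with i show "u = v"
        using triangle_dist_separated[OF d uv] by (simp add: a_def) blast
    next
      fix u v w i assume "u \<in> {p, z, q}" "v \<in> {p, z, q}" "w \<in> {p, z, q}" "i \<in> I"
      then show "a u v i \<le> a u w i + a w v i"
        using triangle_dist_triangle[OF d] le by (simp add: a_def)
    qed (simp_all add: a_def triangle_dist_simps[OF d])
    then have "separated_v_category P_plus {p, z, q} (\<lambda>u v. F (a u v))"
      by (rule sep)
    then have "F (a p q) \<le> F (a p z) + F (a z q)"
      unfolding separated_v_category_P_plus_iff by blast
    then show ?thesis by (simp add: a)
  qed
  then have "triangle_preserving I F"
    unfolding triangle_preserving_def by blast
  moreover have "F v = 0 \<longleftrightarrow> v = (\<lambda>i\<in>I. 0)" if v: "v \<in> I \<rightarrow>\<^sub>E UNIV" for v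
  proof
    assume F0: "F v = 0"
    show "v = (\<lambda>i\<in>I. 0)"
    proof (rule ccontr)
      assume "v \<noteq> (\<lambda>i\<in>I. 0)"
      then have "\<not> (\<forall>i\<in>I. v i = 0)"
        by (simp add: restrict_zero_eq_iff[OF v])
      \<comment> \<open>A single nonzero coordinate of \<open>v\<close> keeps \<open>p\<close> and
        \<open>q\<close> apart, even if the others vanish.\<close>
      then have "separated_v_category (P_plus_power I) {p, q} (\<lambda>x y. if x = y then \<lambda>i\<in>I. 0 else v)"
        using v d by (auto simp: separated_v_category_P_plus_power_iff)
      from sep[OF this] have "p = q"
        by (rule separated_v_category_P_plusD) (use d F0 in auto)
      then show False using d by simp
    qed
  next
    \<comment> \<open>Reflexivity at a single point forces \<open>F\<close> to vanish at the zero
      vector.\<close>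
    have "separated_v_category (P_plus_power I) {p} (\<lambda>x y. \<lambda>i\<in>I. 0)"
      by (simp add: separated_v_category_P_plus_power_iff)
    from sep[OF this] show "F v = 0" if "v = (\<lambda>i\<in>I. 0)"
      using that by (simp add: separated_v_category_P_plus_iff)
  qed
  ultimately show ?R by blast
next
  assume ?R
  then have F: "triangle_preserving I F"
    and zero: "\<And>v. v \<in> I \<rightarrow>\<^sub>E UNIV \<Longrightarrow> F v = 0 \<longleftrightarrow> (\<forall>i\<in>I. v i = 0)"
    by (simp_all add: restrict_zero_eq_iff)
  show ?L
    unfolding separately_preserving_def
  proof (intro CollectI conjI allI impI)
    show "F \<in> carrier (P_plus_power I) \<rightarrow> carrier P_plus"
      by (simp add: P_plus_def)
    fix X :: "'x set" and a
    assume "separated_v_category (P_plus_power I) X a"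
    then show "separated_v_category P_plus X (\<lambda>x y. F (a x y))"
      unfolding separated_v_category_P_plus_power_iff separated_v_category_P_plus_iff
      \<comment> \<open>By \<open>zero\<close>, \<open>F (a x y) = 0\<close> means that all
        coordinates of \<open>a x y\<close> vanish, so separation carries over.\<close>
      by (simp add: zero triangle_preservingD[OF F])
  qed
qed

section \<open>Aggregation of modulars on products\<close>

lemma modular_aggregation_on_products_iff:
  fixes I :: "'i set" and F :: "('i \<Rightarrow> ennreal) \<Rightarrow> ennreal"
  assumes "infinite (UNIV :: 'y set)"
  shows "modular_aggregation_on_products TYPE('y) I F \<longleftrightarrow>
    triangle_preserving I F \<and> (\<forall>v \<in> I \<rightarrow>\<^sub>E UNIV. F v = 0 \<longleftrightarrow> v = (\<lambda>i\<in>I. 0))"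
    (is "?L \<longleftrightarrow> ?R")
proof
  assume F: ?L
  obtain p z q :: 'y where d: "distinct [p, z, q]"
    using assms by (rule infinite_UNIV_obtain_distinct3)
  have agg: "quasi_metric_modular (\<Pi>\<^sub>E i\<in>I. X i) (\<lambda>t x y. F (\<lambda>i\<in>I. w i t (x i) (y i)))"
    if "\<And>i. i \<in> I \<Longrightarrow> quasi_metric_modular (X i) (w i)" for X :: "'i \<Rightarrow> 'y set" and w
    using F that by (simp add: modular_aggregation_on_products_def)
  have "F c \<le> F x + F y"
    if mem: "c \<in> I \<rightarrow>\<^sub>E UNIV" "x \<in> I \<rightarrow>\<^sub>E UNIV" "y \<in> I \<rightarrow>\<^sub>E UNIV"
      and le: "\<forall>i\<in>I. c i \<le> x i + y i" for c x y
  proof -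
    \<comment> \<open>A quasi-metric is a modular constant in \<open>t\<close>. Each factor carries
      its own triangle on the same three points.\<close>
    let ?w = "\<lambda>i (t :: real). triangle_dist p z q (c i) (x i) (y i)"
    have "quasi_metric_modular {p, z, q} (?w i)" if "i \<in> I" for i
      unfolding quasi_metric_modular_def
    proof (intro conjI ballI allI impI)
      fix u v assume uv: "u \<in> {p, z, q}" "v \<in> {p, z, q}"
      show "(\<forall>t>0. ?w i t u v = 0 \<and> ?w i t v u = 0) \<longleftrightarrow> u = v"
        using triangle_dist_separated[OF d uv] triangle_dist_simps(4)[OF d] zero_less_one by blast
      fix w assume "w \<in> {p, z, q}"
      then show "?w i (t + s) u v \<le> ?w i t u w + ?w i s w v" for t s
        using triangle_dist_triangle[OF d] uv le that by blast
    qed (simp_all add: triangle_dist_simps[OF d])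
    then have "quasi_metric_modular (I \<rightarrow>\<^sub>E {p, z, q}) (\<lambda>t u v. F (\<lambda>i\<in>I. ?w i t (u i) (v i)))"
      by (rule agg)
    \<comment> \<open>The constant families realise the triangle in all coordinates at once; the
      times \<open>1\<close> are arbitrary positive values.\<close>
    from quasi_metric_modular_triangle[OF this, of 1 1 "\<lambda>i\<in>I. p" "\<lambda>i\<in>I. q" "\<lambda>i\<in>I. z"]
    have "F (restrict c I) \<le> F (restrict x I) + F (restrict y I)"
      by (simp add: triangle_dist_simps[OF d] cong: restrict_cong)
    then show ?thesis
      using mem by (simp add: PiE_restrict)
  qed
  then have "triangle_preserving I F"
    unfolding triangle_preserving_def by blast
  moreover have "F v = 0 \<longleftrightarrow> v = (\<lambda>i\<in>I. 0)" if v: "v \<in> I \<rightarrow>\<^sub>E UNIV" for v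
  proof -
    \<comment> \<open>In the coordinates where \<open>v\<close> vanishes the two points have to be identified.\<close>
    let ?g = "\<lambda>i. if v i = 0 then p else q"
    let ?w = "\<lambda>i (t :: real) x y :: 'y. if x = y then 0 else v i"
    let ?X = "\<Pi>\<^sub>E i\<in>I. {p, ?g i}"
    let ?p = "\<lambda>i\<in>I. p" and ?q = "\<lambda>i\<in>I. ?g i"
    have "quasi_metric_modular {p, ?g i} (?w i)" for i
      by (auto simp: quasi_metric_modular_def intro: exI[of _ 1])
    then have "quasi_metric_modular ?X (\<lambda>t x y. F (\<lambda>i\<in>I. ?w i t (x i) (y i)))"
      by (rule agg)
    moreover have "?p \<in> ?X" "?q \<in> ?X"
      by auto
    \<comment> \<open>The separation axiom is an equivalence, so it yields both that
      \<open>F\<close> vanishes at the zero vector and that it has no other zero.\<close>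
    ultimately have "(\<forall>t>0. F (\<lambda>i\<in>I. ?w i t (?p i) (?q i)) = 0 \<and>
        F (\<lambda>i\<in>I. ?w i t (?q i) (?p i)) = 0) \<longleftrightarrow> ?p = ?q"
      by (rule quasi_metric_modular_eq_iff)
    \<comment> \<open>Where \<open>v i = 0\<close> the two points agree and have distance
      \<open>0\<close>; elsewhere they differ and have distance \<open>v i\<close>.\<close>
    moreover have "(\<lambda>i\<in>I. ?w i t (?p i) (?q i)) = v" "(\<lambda>i\<in>I. ?w i t (?q i) (?p i)) = v" for t
      by (rule PiE_ext[OF _ v]; use d in auto)+
    ultimately have "F v = 0 \<longleftrightarrow> ?p = ?q"
      by (simp only: conj_absorb) (blast intro: zero_less_one)
    also have "\<dots> \<longleftrightarrow> (\<forall>i\<in>I. v i = 0)"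
      using d by (auto simp: fun_eq_iff restrict_def)
    finally show ?thesis
      by (simp add: restrict_zero_eq_iff[OF v])
  qed
  ultimately show ?R by blast
next
  assume ?R
  then have F: "triangle_preserving I F"
    and zero: "\<And>v. v \<in> I \<rightarrow>\<^sub>E UNIV \<Longrightarrow> F v = 0 \<longleftrightarrow> (\<forall>i\<in>I. v i = 0)"
    by (simp_all add: restrict_zero_eq_iff)
  show ?L
    unfolding modular_aggregation_on_products_def
  proof (intro allI impI)
    fix X :: "'i \<Rightarrow> 'y set" and w
    assume w: "\<forall>i\<in>I. quasi_metric_modular (X i) (w i)"
    let ?d = "\<lambda>t x y. \<lambda>i\<in>I. w i t (x i) (y i)"
    show "quasi_metric_modular (\<Pi>\<^sub>E i\<in>I. X i) (\<lambda>t x y. F (?d t x y))"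
      unfolding quasi_metric_modular_def
    proof (intro conjI allI ballI impI)
      show "(\<Pi>\<^sub>E i\<in>I. X i) \<noteq> {}"
        using w by (auto simp: PiE_eq_empty_iff quasi_metric_modular_def)
      show "F (?d t x x) = 0" if "t > 0" "x \<in> (\<Pi>\<^sub>E i\<in>I. X i)" for t x
        using w that by (auto simp: zero quasi_metric_modular_def PiE_mem)
      show "F (?d (t + s) x y) \<le> F (?d t x z) + F (?d s z y)"
        if "t > 0" "s > 0" and xyz: "x \<in> (\<Pi>\<^sub>E i\<in>I. X i)" "y \<in> (\<Pi>\<^sub>E i\<in>I. X i)" "z \<in> (\<Pi>\<^sub>E i\<in>I. X i)"
        for t s x y z
      proof (rule triangle_preservingD[OF F])
        fix i assume i: "i \<in> I"
        then have "x i \<in> X i" "y i \<in> X i" "z i \<in> X i"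
          using xyz by (simp_all add: PiE_mem)
        then show "?d (t + s) x y i \<le> ?d t x z i + ?d s z y i"
          using w i \<open>t > 0\<close> \<open>s > 0\<close> by (simp add: quasi_metric_modular_def)
      qed simp_all
      fix x y assume xy: "x \<in> (\<Pi>\<^sub>E i\<in>I. X i)" "y \<in> (\<Pi>\<^sub>E i\<in>I. X i)"
      \<comment> \<open>By \<open>zero\<close> the quantifiers over \<open>t\<close> and
        \<open>i\<close> can be exchanged, which leaves the separation axiom of each factor.\<close>
      have "(\<forall>t>0. F (?d t x y) = 0 \<and> F (?d t y x) = 0) \<longleftrightarrow>
          (\<forall>i\<in>I. \<forall>t>0. w i t (x i) (y i) = 0 \<and> w i t (y i) (x i) = 0)"
        by (auto simp: zero)
      also have "\<dots> \<longleftrightarrow> (\<forall>i\<in>I. x i = y i)"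
      proof (rule ball_cong[OF refl])
        fix i assume i: "i \<in> I"
        then have "x i \<in> X i" "y i \<in> X i"
          using xy by (simp_all add: PiE_mem)
        then show "(\<forall>t>0. w i t (x i) (y i) = 0 \<and> w i t (y i) (x i) = 0) \<longleftrightarrow> x i = y i"
          using w i by (simp add: quasi_metric_modular_def)
      qed
      also have "\<dots> \<longleftrightarrow> x = y"
        using PiE_ext[OF xy] by blast
      finally show "(\<forall>t>0. F (?d t x y) = 0 \<and> F (?d t y x) = 0) \<longleftrightarrow> x = y" .
    qed
  qed
qed

theorem theorem8p1:
  fixes I :: "'i set" and F :: "('i \<Rightarrow> ennreal) \<Rightarrow> ennreal"
  assumes "infinite (UNIV :: 'x set)" and "infinite (UNIV :: 'y set)"
  shows "(F \<in> separately_preserving TYPE('x) (P_plus_power I) P_plus \<longleftrightarrow>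
            modular_aggregation_on_products TYPE('y) I F) \<and>
         (modular_aggregation_on_products TYPE('y) I F \<longleftrightarrow>
            isotone_on_product I F \<and> subadditive_on_product I F \<and>
            {v \<in> I \<rightarrow>\<^sub>E UNIV. F v = 0} = {\<lambda>i\<in>I. 0})"
  \<comment> \<open>All three conditions become the same formula, which mentions no points, so
    \<open>'x\<close> and \<open>'y\<close> may differ.\<close>
  unfolding separately_preserving_P_plus_power_iff[OF assms(1)]
    modular_aggregation_on_products_iff[OF assms(2)] isotone_subadditive_zero_iff
  by simp

end
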